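(* Let $r>1$ and let $T$ be an invertible bounded linear operator on a complex Hilbert space $\mathcal{H}$ with $\|T\|\le r$ and $\|T^{-1}\|\le r$. Put $\beta(T^*,T)=(r^2+r^{-2})I-T^*T-(T^*T)^{-1}$. Then the operator on $\mathcal{H}\oplus\mathcal{H}$ given by $$\hat{T}=\begin{bmatrix} T & T(T^*T)^{-1/2}\beta(T^*,T)^{1/2}\\ 0 & T^{-*}\end{bmatrix}$$ is a quantum annulus unitary, and $T$ extends (and hence dilates) to $\hat T$.
   Context: All operators are bounded linear maps on complex Hilbert spaces. For an invertible operator $T$, $T^{-*}=(T^{-1})^*$. The quantum annulus $Q\mathbb{A}_r$ is the class of invertible operators $T$ with $\|T\|,\|T^{-1}\|\le r$. It is known that an invertible operator $T$ belongs to $Q\mathbb{A}_r$ if and only if $\beta(T^*,T)\ge 0$, so that the positive square root $\beta(T^*,T)^{1/2}$ makes sense. An invertible operator $J$ is a quantum annulus unitary if $\beta(J^*,J)=(r^2+r^{-2})I-J^*J-(J^*J)^{-1}=0$. Identify $\mathcal{H}$ with $\mathcal{H}\oplus\{0\}\subseteq\mathcal{H}\oplus\mathcal{H}$. "$T$ extends to $\hat T$" means $\mathcal{H}$ is invariant under $\hat T$ and $\hat T|_{\mathcal{H}}=T$; "$T$ dilates to $\hat T$" means $T^n=P_{\mathcal{H}}\hat T^n|_{\mathcal{H}}$ for all $n\in\mathbb{Z}$, where $P_{\mathcal{H}}$ is the orthogonal projection onto $\mathcal{H}$. *)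

theory Defs
  imports "HOL-Analysis.Analysis"
begin

text \<open>
  Complex inner product spaces and complex Hilbert spaces.  The class extends \<open>real_inner\<close>, so
  that norm, topology, \<open>onorm\<close> and the product type are those of the library; the real inner
  product is the real part of the complex one, whence \<open>(norm x)\<^sup>2 = Re (cinner x x)\<close>.
  The complex inner product is linear in its first argument.
\<close>

class complex_inner = real_inner +
  fixes scaleC :: "complex \<Rightarrow> 'a \<Rightarrow> 'a"  (infixr \<open>*\<^sub>C\<close> 75)
    and cinner :: "'a \<Rightarrow> 'a \<Rightarrow> complex"
  assumes scaleC_add_right: "c *\<^sub>C (x + y) = c *\<^sub>C x + c *\<^sub>C y"
    and scaleC_add_left: "(c + d) *\<^sub>C x = c *\<^sub>C x + d *\<^sub>C x"
    and scaleC_scaleC: "c *\<^sub>C (d *\<^sub>C x) = (c * d) *\<^sub>C x"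
    and scaleR_scaleC: "t *\<^sub>R x = complex_of_real t *\<^sub>C x"
    and cinner_commute: "cinner x y = cnj (cinner y x)"
    and cinner_add_left: "cinner (x + y) z = cinner x z + cinner y z"
    and cinner_scaleC_left: "cinner (c *\<^sub>C x) y = c * cinner x y"
    and inner_eq_Re_cinner: "inner x y = Re (cinner x y)"

class complex_hilbert = complex_inner + complete_space

instantiation complex :: complex_hilbert
begin

definition "c *\<^sub>C (x::complex) = c * x"

definition "cinner x (y::complex) = x * cnj y"

instance
  by standard
    (auto simp: scaleC_complex_def cinner_complex_def inner_complex_def algebra_simps
      scaleR_conv_of_real)

end

text \<open>The Hilbert space direct sum is the product type.\<close>

instantiation prod :: (complex_inner, complex_inner) complex_inner
begin

definition "c *\<^sub>C (p :: 'a \<times> 'b) = (c *\<^sub>C fst p, c *\<^sub>C snd p)"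

definition "cinner p (q :: 'a \<times> 'b) = cinner (fst p) (fst q) + cinner (snd p) (snd q)"

instance
proof
  fix p q :: "'a \<times> 'b"
  show "cinner p q = cnj (cinner q p)"
    unfolding cinner_prod_def complex_cnj_add
    by (subst (1 2) cinner_commute) (rule refl)
qed (auto simp: scaleC_prod_def cinner_prod_def inner_prod_def scaleC_add_right scaleC_add_left
    scaleC_scaleC scaleR_scaleC scaleR_prod_def cinner_add_left cinner_scaleC_left
    inner_eq_Re_cinner algebra_simps)

end

instance prod :: (complex_hilbert, complex_hilbert) complex_hilbert ..

definition bounded_clinear :: "('a::complex_inner \<Rightarrow> 'b::complex_inner) \<Rightarrow> bool" where
  "bounded_clinear T \<longleftrightarrow> bounded_linear T \<and> (\<forall>c x. T (c *\<^sub>C x) = c *\<^sub>C T x)"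

text \<open>For an invertible operator \<open>T\<close>, the inverse operator is the library's \<open>inv T\<close>.\<close>

definition invertible_op :: "('a::complex_inner \<Rightarrow> 'a) \<Rightarrow> bool" where
  "invertible_op T \<longleftrightarrow>
    bounded_clinear T \<and> (\<exists>S. bounded_clinear S \<and> S \<circ> T = id \<and> T \<circ> S = id)"

definition cadjoint :: "('a::complex_inner \<Rightarrow> 'b::complex_inner) \<Rightarrow> 'b \<Rightarrow> 'a" where
  "cadjoint T = (THE S. \<forall>x y. cinner (T x) y = cinner x (S y))"

definition positive_op :: "('a::complex_inner \<Rightarrow> 'a) \<Rightarrow> bool" where
  "positive_op A \<longleftrightarrow>
    bounded_clinear A \<and> (\<forall>x. cinner (A x) x \<in> \<real> \<and> 0 \<le> Re (cinner (A x) x))"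

definition sqrt_op :: "('a::complex_inner \<Rightarrow> 'a) \<Rightarrow> 'a \<Rightarrow> 'a" where
  "sqrt_op A = (THE S. positive_op S \<and> S \<circ> S = A)"

definition quantum_annulus :: "real \<Rightarrow> ('a::complex_inner \<Rightarrow> 'a) set" where
  "quantum_annulus r = {T. invertible_op T \<and> onorm T \<le> r \<and> onorm (inv T) \<le> r}"

definition beta :: "real \<Rightarrow> ('a::complex_inner \<Rightarrow> 'a) \<Rightarrow> 'a \<Rightarrow> 'a" where
  "beta r T = (\<lambda>x. (r\<^sup>2 + 1 / r\<^sup>2) *\<^sub>R x - (cadjoint T \<circ> T) x - inv (cadjoint T \<circ> T) x)"

definition quantum_annulus_unitary :: "real \<Rightarrow> ('a::complex_inner \<Rightarrow> 'a) \<Rightarrow> bool" where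
  "quantum_annulus_unitary r J \<longleftrightarrow> invertible_op J \<and> beta r J = (\<lambda>x. 0)"

definition block_op ::
  "('a::complex_inner \<Rightarrow> 'a) \<Rightarrow> ('a \<Rightarrow> 'a) \<Rightarrow> ('a \<Rightarrow> 'a) \<Rightarrow> ('a \<Rightarrow> 'a) \<Rightarrow> 'a \<times> 'a \<Rightarrow> 'a \<times> 'a" where
  "block_op A B C D = (\<lambda>(x, y). (A x + B y, C x + D y))"

text \<open>Here \<open>(T\<^sup>*T)\<^sup>-\<^sup>1\<^sup>/\<^sup>2\<close> is read as the positive square root of \<open>(T\<^sup>*T)\<^sup>-\<^sup>1\<close>.\<close>

definition T_hat :: "real \<Rightarrow> ('a::complex_inner \<Rightarrow> 'a) \<Rightarrow> 'a \<times> 'a \<Rightarrow> 'a \<times> 'a" where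
  "T_hat r T =
    block_op T (T \<circ> sqrt_op (inv (cadjoint T \<circ> T)) \<circ> sqrt_op (beta r T))
             (\<lambda>x. 0) (cadjoint (inv T))"

text \<open>
  The copy \<open>H \<oplus> {0}\<close> of \<open>H\<close> inside \<open>H \<oplus> H\<close>; a vector \<open>x\<close> of \<open>H\<close> is identified with \<open>(x, 0)\<close>.
\<close>

definition first_summand :: "('a::complex_inner \<times> 'a) set" where
  "first_summand = UNIV \<times> {0}"

definition orth_proj :: "'a::complex_inner set \<Rightarrow> 'a \<Rightarrow> 'a" where
  "orth_proj M x = (THE p. p \<in> M \<and> (\<forall>m\<in>M. cinner (x - p) m = 0))"

text \<open>Integer powers; for negative exponents meaningful only if \<open>T\<close> is invertible.\<close>

definition op_powi :: "('a \<Rightarrow> 'a) \<Rightarrow> int \<Rightarrow> 'a \<Rightarrow> 'a" where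
  "op_powi T n = (if 0 \<le> n then T ^^ nat n else inv T ^^ nat (- n))"

definition extends_to :: "('a::complex_inner \<Rightarrow> 'a) \<Rightarrow> ('a \<times> 'a \<Rightarrow> 'a \<times> 'a) \<Rightarrow> bool" where
  "extends_to T T' \<longleftrightarrow>
    T' ` first_summand \<subseteq> first_summand \<and> (\<forall>x. T' (x, 0) = (T x, 0))"

definition dilates_to :: "('a::complex_inner \<Rightarrow> 'a) \<Rightarrow> ('a \<times> 'a \<Rightarrow> 'a \<times> 'a) \<Rightarrow> bool" where
  "dilates_to T T' \<longleftrightarrow>
    (\<forall>n x. (op_powi T n x, 0) = orth_proj first_summand (op_powi T' n (x, 0)))"

end

theory Submission
  imports Defs
begin

text \<open>
  Write \<open>P = T\<^sup>* T\<close>, \<open>c = r\<^sup>2 + r\<^sup>-\<^sup>2\<close> and \<open>\<beta> = c I - P - P\<^sup>-\<^sup>1\<close>.  Everything rests on one computation with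
  commuting operators.  The off-diagonal entry of the extension is \<open>D = T P\<^sup>-\<^sup>1\<^sup>/\<^sup>2 \<beta>\<^sup>1\<^sup>/\<^sup>2\<close>; since \<open>T P\<^sup>-\<^sup>1\<^sup>/\<^sup>2\<close> is
  unitary, \<open>D\<^sup>* D = \<beta>\<close>, and \<open>T\<^sup>* D = K\<close> with \<open>K = P\<^sup>1\<^sup>/\<^sup>2 \<beta>\<^sup>1\<^sup>/\<^sup>2\<close>.  Therefore the extension \<open>J\<close> satisfies
  \<open>J\<^sup>* J = [P, K; K, c I - P]\<close>, a matrix of commuting entries whose determinant
  \<open>P (c I - P) - K\<^sup>2 = P (c I - P - \<beta>)\<close> is the identity.  Its inverse is the adjugate
  \<open>[c I - P, -K; -K, P]\<close>, and the two matrices add up to \<open>c I\<close>, which says that \<open>J\<close> is a quantum annulus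
  unitary.  These steps are \<open>cadjoint_T_hat_compose\<close>, \<open>inv_cadjoint_T_hat_compose\<close> and \<open>beta_T_hat\<close>.

  The computation presupposes that \<open>\<beta>\<close> is positive, that positive operators have unique positive square
  roots, and that these roots commute with whatever the operator commutes with.  Positivity of \<open>\<beta>\<close>
  follows from the factorisation \<open>r\<^sup>2 \<beta> = (r\<^sup>2 I - P) (r\<^sup>2 I - P\<^sup>-\<^sup>1)\<close> into commuting positive factors, where
  positivity of the product again uses a square root.  The root of \<open>A\<close> is built, after scaling, as the
  binomial series of \<open>(1 - t)\<^sup>1\<^sup>/\<^sup>2\<close> in the contraction \<open>I - A\<close>, whose coefficients are absolutely summable
  (\<open>ex_pos_sqrt\<close>); its commutation property is also what makes the root unique.  Adjoints come from the
  Riesz representation theorem.  All the analysis takes place in real Hilbert spaces; the complex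
  structure comes back because the operators commute with multiplication by scalars.

  Dilation is a consequence of extension: \<open>J\<close> and its inverse both map \<open>(x, 0)\<close> into the first summand, so
  all integer powers do.
\<close>

section \<open>Power series in a contraction\<close>

text \<open>
  The operator \<open>c(B)\<close> for a power series \<open>c\<close>.  It is formed pointwise, since bounded operators are
  handled here as plain functions rather than as elements of a Banach algebra.
\<close>
definition op_series :: "(nat \<Rightarrow> real) \<Rightarrow> ('a::banach \<Rightarrow> 'a) \<Rightarrow> 'a \<Rightarrow> 'a" where
  "op_series c B x = (\<Sum>n. c n *\<^sub>R (B ^^ n) x)"

locale contraction =
  fixes B :: "'a::banach \<Rightarrow> 'a"
  assumes lin: "bounded_linear B"
    and contract: "norm (B x) \<le> norm x"
begin

lemma bounded_linear_funpow: "bounded_linear (B ^^ n)"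
proof (induction n)
  case (Suc n)
  then show ?case
    using bounded_linear_compose[OF lin Suc] by (simp add: o_def)
qed (simp add: id_def)

lemma norm_funpow_le: "norm ((B ^^ n) x) \<le> norm x"
  by (induction n) (auto intro: order_trans[OF contract])

lemma abs_summable_terms:
  assumes "summable (\<lambda>n. \<bar>c n\<bar>)"
  shows "summable (\<lambda>n. norm (c n *\<^sub>R (B ^^ n) x))"
proof (rule summable_comparison_test')
  show "summable (\<lambda>n. \<bar>c n\<bar> * norm x)"
    using assms by (rule summable_mult2)
  show "norm (norm (c n *\<^sub>R (B ^^ n) x)) \<le> \<bar>c n\<bar> * norm x" for n
    by (simp add: mult_left_mono norm_funpow_le)
qed

lemma summable_terms:
  assumes "summable (\<lambda>n. \<bar>c n\<bar>)"
  shows "summable (\<lambda>n. c n *\<^sub>R (B ^^ n) x)"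
  by (rule summable_norm_cancel[OF abs_summable_terms[OF assms]])

text \<open>
  Whatever commutes with \<open>B\<close> commutes with all its powers, and by continuity with \<open>c(B)\<close>.  Everything
  that is later known about how square roots commute comes from here.
\<close>
lemma op_series_commute:
  assumes c: "summable (\<lambda>n. \<bar>c n\<bar>)" and C: "bounded_linear C"
    and comm: "\<And>x. C (B x) = B (C x)"
  shows "C (op_series c B x) = op_series c B (C x)"
proof -
  interpret C: bounded_linear C by (rule C)
  have "C ((B ^^ n) x) = (B ^^ n) (C x)" for n
    by (induction n) (auto simp: comm)
  then show ?thesis
    unfolding op_series_def
    by (simp add: C.suminf[OF summable_terms[OF c]] C.scaleR)
qed

lemma bounded_linear_op_series:
  assumes c: "summable (\<lambda>n. \<bar>c n\<bar>)"
  shows "bounded_linear (op_series c B)"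
proof (rule bounded_linear_intro)
  interpret P: bounded_linear "B ^^ n" for n by (rule bounded_linear_funpow)
  show "op_series c B (x + y) = op_series c B x + op_series c B y" for x y
    unfolding op_series_def
    by (simp add: P.add scaleR_add_right suminf_add summable_terms[OF c])
  show "op_series c B (t *\<^sub>R x) = t *\<^sub>R op_series c B x" for t x
    unfolding op_series_def suminf_scaleR_right[OF summable_terms[OF c]]
    by (simp add: P.scaleR mult.commute)
  show "norm (op_series c B x) \<le> norm x * (\<Sum>n. \<bar>c n\<bar>)" for x
  proof -
    have "norm (op_series c B x) \<le> (\<Sum>n. norm (c n *\<^sub>R (B ^^ n) x))"
      unfolding op_series_def by (rule summable_norm[OF abs_summable_terms[OF c]])
    also have "\<dots> \<le> (\<Sum>n. norm x * \<bar>c n\<bar>)"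
      by (rule suminf_le[OF _ abs_summable_terms[OF c] summable_mult[OF c]])
        (simp add: mult.commute[of "norm x"] mult_left_mono norm_funpow_le)
    also have "\<dots> = norm x * (\<Sum>n. \<bar>c n\<bar>)"
      by (rule suminf_mult[OF c])
    finally show ?thesis .
  qed
qed

lemma has_sum_op_series:
  assumes "summable (\<lambda>n. \<bar>c n\<bar>)"
  shows "((\<lambda>n. c n *\<^sub>R (B ^^ n) x) has_sum op_series c B x) UNIV"
  unfolding op_series_def
  by (rule norm_summable_imp_has_sum[OF abs_summable_terms[OF assms] summable_sums[OF summable_terms[OF assms]]])

text \<open>
  The Cauchy product.  The double family \<open>c\<^sub>m d\<^sub>n B\<^sup>m\<^sup>+\<^sup>n x\<close> is dominated by \<open>\<bar>c\<^sub>m\<bar> \<bar>d\<^sub>n\<bar> \<parallel>x\<parallel>\<close>, so it may be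
  summed either row by row, which gives the composition, or along the diagonals \<open>m + n = k\<close>, which
  gives the series of the convolution.
\<close>
lemma op_series_compose:
  assumes c: "summable (\<lambda>n. \<bar>c n\<bar>)" and d: "summable (\<lambda>n. \<bar>d n\<bar>)"
  shows "op_series c B (op_series d B x) = op_series (\<lambda>k. \<Sum>i\<le>k. c i * d (k - i)) B x"
proof -
  interpret P: bounded_linear "B ^^ n" for n by (rule bounded_linear_funpow)
  define g where "g = (\<lambda>(m, n). (c m * d n) *\<^sub>R (B ^^ (m + n)) x)"
  define \<phi> where "\<phi> = (\<lambda>(k, i). (i, k - i :: nat))"
  have cd: "(\<lambda>(m, n). norm (c m * d n)) summable_on UNIV \<times> UNIV"
  proof -
    have "(\<lambda>(m, n). \<bar>c m\<bar> * \<bar>d n\<bar>) summable_on UNIV \<times> UNIV"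
    proof (rule summable_on_SigmaI[where g = "\<lambda>m. \<bar>c m\<bar> * (\<Sum>n. \<bar>d n\<bar>)"])
      have D: "((\<lambda>n. \<bar>d n\<bar>) has_sum (\<Sum>n. \<bar>d n\<bar>)) UNIV"
        using d by (intro norm_summable_imp_has_sum) (auto simp: summable_sums)
      show "((\<lambda>n. case (m, n) of (m, n) \<Rightarrow> \<bar>c m\<bar> * \<bar>d n\<bar>) has_sum \<bar>c m\<bar> * (\<Sum>n. \<bar>d n\<bar>)) UNIV"
        for m using has_sum_cmult_right[OF D, of "\<bar>c m\<bar>"] by simp
      show "(\<lambda>m. \<bar>c m\<bar> * (\<Sum>n. \<bar>d n\<bar>)) summable_on UNIV"
        using c by (intro summable_on_cmult_left norm_summable_imp_summable_on) simp
    qed auto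
    then show ?thesis by (simp add: abs_mult)
  qed
  have gs: "g summable_on UNIV \<times> UNIV"
  proof -
    have bound: "(\<lambda>p. (case p of (m, n) \<Rightarrow> norm (c m * d n)) * norm x) summable_on UNIV \<times> UNIV"
      using cd by (rule summable_on_cmult_left)
    have "(\<lambda>p. norm (g p)) summable_on UNIV \<times> UNIV"
      by (rule summable_on_comparison_test[OF bound])
        (auto simp: g_def intro!: mult_left_mono norm_funpow_le)
    then show ?thesis
      by (rule abs_summable_summable)
  qed
  have bij: "bij_betw \<phi> (Sigma UNIV (\<lambda>k. {..k})) (UNIV \<times> UNIV)"
    by (rule bij_betwI[where g = "\<lambda>(i, j). (i + j, i)"]) (auto simp: \<phi>_def)
  have "op_series c B (op_series d B x) = (\<Sum>\<^sub>\<infinity>m. c m *\<^sub>R (B ^^ m) (op_series d B x))"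
    by (rule infsumI[OF has_sum_op_series[OF c], symmetric])
  also have "\<dots> = (\<Sum>\<^sub>\<infinity>m. \<Sum>\<^sub>\<infinity>n. g (m, n))"
  proof (rule infsum_cong)
    fix m
    have "((\<lambda>n. c m *\<^sub>R (B ^^ m) (d n *\<^sub>R (B ^^ n) x)) has_sum c m *\<^sub>R (B ^^ m) (op_series d B x)) UNIV"
      using has_sum_bounded_linear[OF bounded_linear_compose[OF bounded_linear_scaleR_right P.bounded_linear_axioms]
          has_sum_op_series[OF d], of "c m" m] by (simp add: o_def)
    then show "c m *\<^sub>R (B ^^ m) (op_series d B x) = (\<Sum>\<^sub>\<infinity>n. g (m, n))"
      by (intro infsumI[symmetric]) (simp add: g_def P.scaleR funpow_add)
  qed
  also have "\<dots> = infsum g (UNIV \<times> UNIV)"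
    using gs by (rule infsum_Sigma_banach)
  also have "\<dots> = (\<Sum>\<^sub>\<infinity>p\<in>Sigma UNIV (\<lambda>k. {..k}). g (\<phi> p))"
    by (rule infsum_reindex_bij_betw[OF bij, symmetric])
  also have "\<dots> = (\<Sum>\<^sub>\<infinity>k. \<Sum>\<^sub>\<infinity>i\<in>{..k}. g (\<phi> (k, i)))"
    using gs by (intro infsum_Sigma_banach[symmetric]) (simp add: summable_on_reindex_bij_betw[OF bij])
  also have "\<dots> = op_series (\<lambda>k. \<Sum>i\<le>k. c i * d (k - i)) B x"
  proof -
    have "(\<lambda>p. g (\<phi> p)) summable_on Sigma UNIV (\<lambda>k. {..k})"
      using gs by (simp add: summable_on_reindex_bij_betw[OF bij])
    then have "(\<lambda>k. \<Sum>\<^sub>\<infinity>i\<in>{..k}. g (\<phi> (k, i))) summable_on UNIV"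
      by (intro summable_on_Sigma_banach) (simp add: split_def)
    from has_sum_imp_sums[OF has_sum_infsum[OF this]]
    have "(\<Sum>\<^sub>\<infinity>k. \<Sum>\<^sub>\<infinity>i\<in>{..k}. g (\<phi> (k, i))) = (\<Sum>k. \<Sum>i\<le>k. g (\<phi> (k, i)))"
      by (simp add: sums_iff)
    then show ?thesis
      by (simp add: op_series_def g_def \<phi>_def scaleR_left.sum)
  qed
  finally show ?thesis .
qed

end

section \<open>The binomial series of the square root\<close>

text \<open>
  The Taylor coefficients of \<open>(1 - t)\<^sup>1\<^sup>/\<^sup>2\<close> at \<open>t = 0\<close>, in a form that shows their signs.
\<close>
definition sqrt_coeff :: "nat \<Rightarrow> real" where
  "sqrt_coeff n = pochhammer (- 1 / 2) n / fact n"

lemma sqrt_coeff_0: "sqrt_coeff 0 = 1"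
  by (simp add: sqrt_coeff_def)

lemma sqrt_coeff_nonpos:
  assumes "n \<noteq> 0"
  shows "sqrt_coeff n \<le> 0"
proof -
  from assms obtain m where "n = Suc m"
    using not0_implies_Suc by blast
  then show ?thesis
    using pochhammer_nonneg[of "1 / 2 :: real" m]
    by (simp add: sqrt_coeff_def pochhammer_rec divide_nonneg_pos)
qed

text \<open>
  Summing coefficients corresponds to division by \<open>1 - t\<close>, so the partial sums are the coefficients of
  \<open>(1 - t)\<^sup>-\<^sup>1\<^sup>/\<^sup>2\<close>, which are visibly nonnegative.  This yields both absolute convergence at \<open>t = 1\<close> and
  positivity of the resulting operator.
\<close>
lemma sum_sqrt_coeff: "(\<Sum>k\<le>m. sqrt_coeff k) = pochhammer (1 / 2) m / fact m"
proof (induction m)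
  case (Suc m)
  have "(\<Sum>k\<le>Suc m. sqrt_coeff k) = pochhammer (1 / 2) m / fact m - (1 / 2) * pochhammer (1 / 2) m / fact (Suc m)"
    using Suc by (simp add: sqrt_coeff_def pochhammer_rec)
  also have "\<dots> = pochhammer (1 / 2) (Suc m) / fact (Suc m)"
  proof -
    have "1 + real m \<noteq> 0" by linarith
    then show ?thesis by (simp add: pochhammer_Suc divide_simps) (simp add: algebra_simps)
  qed
  finally show ?case .
qed (simp add: sqrt_coeff_def)

lemma sum_sqrt_coeff_nonneg: "0 \<le> (\<Sum>k\<le>m. sqrt_coeff k)"
  by (simp add: sum_sqrt_coeff pochhammer_nonneg)

lemma abs_sqrt_coeff: "\<bar>sqrt_coeff n\<bar> = (if n = 0 then 2 else 0) - sqrt_coeff n"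
  using sqrt_coeff_nonpos[of n] by (auto simp: sqrt_coeff_0)

lemma summable_abs_sqrt_coeff: "summable (\<lambda>n. \<bar>sqrt_coeff n\<bar>)"
proof (rule bounded_imp_summable)
  \<comment> \<open>Only the leading coefficient 1 is positive, so the remaining ones add up to at least -1.\<close>
  show "(\<Sum>k\<le>n. \<bar>sqrt_coeff k\<bar>) \<le> 2" for n
    using sum_sqrt_coeff_nonneg[of n] by (simp add: abs_sqrt_coeff sum_subtractf sum.delta)
qed simp

text \<open>
  The coefficient form of \<open>(1 - t)\<^sup>1\<^sup>/\<^sup>2 (1 - t)\<^sup>1\<^sup>/\<^sup>2 = 1 - t\<close>, by Vandermonde's identity.
\<close>
lemma sqrt_coeff_convolution:
  "(\<Sum>i\<le>k. sqrt_coeff i * sqrt_coeff (k - i)) = (if k = 0 then 1 else if k = 1 then - 1 else 0)"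
proof -
  have c: "sqrt_coeff n = (- 1) ^ n * ((1 / 2) gchoose n)" for n
    by (simp add: sqrt_coeff_def gbinomial_pochhammer flip: power_mult_distrib)
  have "(\<Sum>i\<le>k. sqrt_coeff i * sqrt_coeff (k - i))
      = (\<Sum>i = 0..k. (- 1) ^ k * (((1 / 2) gchoose i) * ((1 / 2) gchoose (k - i))))"
    by (rule sum.cong) (auto simp: c power_add[symmetric])
  also have "\<dots> = (- 1) ^ k * (1 gchoose k)"
    using gbinomial_Vandermonde[of "1 / 2 :: real" "1 / 2" k] by (simp flip: sum_distrib_left)
  also have "\<dots> = (- 1) ^ k * real (1 choose k)"
    by (simp add: binomial_gbinomial)
  also have "\<dots> = (if k = 0 then 1 else if k = 1 then - 1 else 0)"
    by (cases k) auto
  finally show ?thesis .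
qed

section \<open>Square roots of positive operators\<close>

text \<open>
  Positivity in a \<^emph>\<open>real\<close> Hilbert space, where symmetry has to be required separately.  The analysis of
  square roots is done at this level; in the complex case linearity over the complex numbers is
  recovered from the fact that the root commutes with multiplication by scalars.
\<close>
definition pos_selfadj :: "('a::real_inner \<Rightarrow> 'a) \<Rightarrow> bool" where
  "pos_selfadj A \<longleftrightarrow>
    bounded_linear A \<and> (\<forall>x y. A x \<bullet> y = x \<bullet> A y) \<and> (\<forall>x. 0 \<le> A x \<bullet> x)"

lemma pos_selfadjD:
  assumes "pos_selfadj A"
  shows "bounded_linear A" "A x \<bullet> y = x \<bullet> A y" "0 \<le> A x \<bullet> x"
  using assms by (auto simp: pos_selfadj_def)

lemma pos_selfadj_scaleR:
  assumes "pos_selfadj A" "0 \<le> t"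
  shows "pos_selfadj (\<lambda>x. t *\<^sub>R A x)"
  using assms by (auto simp: pos_selfadj_def intro: bounded_linear_compose[OF bounded_linear_scaleR_right])

text \<open>
  Expand \<open>0 \<le> \<langle>A (x - A x), x - A x\<rangle>\<close> and estimate the cubic term \<open>\<langle>A\<^sup>2 x, A x\<rangle>\<close> by \<open>\<parallel>A x\<parallel>\<^sup>2\<close>.  In short,
  \<open>A\<^sup>2 \<le> A\<close> for a positive contraction.
\<close>
lemma pos_selfadj_norm_le:
  assumes A: "pos_selfadj A" and le: "\<And>x. norm (A x) \<le> norm x"
  shows "(norm (A x))\<^sup>2 \<le> A x \<bullet> x"
proof -
  interpret A: bounded_linear A using pos_selfadjD(1)[OF A] .
  have "0 \<le> A (x - A x) \<bullet> (x - A x)"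
    by (rule pos_selfadjD(3)[OF A])
  also have "\<dots> = A x \<bullet> x - 2 * (norm (A x))\<^sup>2 + A (A x) \<bullet> A x"
    using pos_selfadjD(2)[OF A, of "A x" x]
    by (simp add: A.diff inner_diff inner_commute power2_norm_eq_inner)
  also have "A (A x) \<bullet> A x \<le> norm (A (A x)) * norm (A x)"
    by (rule norm_cauchy_schwarz)
  also have "\<dots> \<le> norm (A x) * norm (A x)"
    by (intro mult_right_mono le) simp
  finally show ?thesis by (simp add: power2_eq_square)
qed

lemma pos_selfadj_bounded:
  assumes A: "pos_selfadj A"
  obtains K where "0 < K" "pos_selfadj (\<lambda>x. (1 / K) *\<^sub>R A x)"
    "\<And>x. norm ((1 / K) *\<^sub>R A x) \<le> norm x"
proof -
  obtain K where K: "0 < K" "\<And>x. norm (A x) \<le> norm x * K"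
    using bounded_linear.pos_bounded[OF pos_selfadjD(1)[OF A]] by blast
  show ?thesis
  proof (rule that[OF K(1)])
    show "pos_selfadj (\<lambda>x. (1 / K) *\<^sub>R A x)"
      using K by (intro pos_selfadj_scaleR A) auto
    show "norm ((1 / K) *\<^sub>R A x) \<le> norm x" for x
      using K by (simp add: field_simps)
  qed
qed

lemma pos_selfadj_eq_0:
  assumes A: "pos_selfadj A" and "A x \<bullet> x = 0"
  shows "A x = 0"
proof -
  obtain K where K: "0 < K" "pos_selfadj (\<lambda>x. (1 / K) *\<^sub>R A x)"
    "\<And>x. norm ((1 / K) *\<^sub>R A x) \<le> norm x"
    using pos_selfadj_bounded[OF A] by blast
  show ?thesis
    using pos_selfadj_norm_le[OF K(2,3), of x] assms(2) K(1) by simp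
qed

text \<open>
  By \<open>A\<^sup>2 \<le> A\<close>, \<open>\<parallel>x - A x\<parallel>\<^sup>2 = \<parallel>x\<parallel>\<^sup>2 - 2 \<langle>A x, x\<rangle> + \<parallel>A x\<parallel>\<^sup>2 \<le> \<parallel>x\<parallel>\<^sup>2 - \<langle>A x, x\<rangle>\<close>.
\<close>
lemma contraction_one_minus:
  fixes A :: "'a::{real_inner,banach} \<Rightarrow> 'a"
  assumes A: "pos_selfadj A" and le: "\<And>x. norm (A x) \<le> norm x"
  shows "contraction (\<lambda>x. x - A x)"
proof (rule contraction.intro)
  show "bounded_linear (\<lambda>x. x - A x)"
    by (intro bounded_linear_sub bounded_linear_ident pos_selfadjD(1)[OF A])
  fix x
  have "(norm (x - A x))\<^sup>2 = (norm x)\<^sup>2 - 2 * (A x \<bullet> x) + (norm (A x))\<^sup>2"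
    unfolding power2_norm_eq_inner by (simp add: inner_diff inner_commute)
  also have "\<dots> \<le> (norm x)\<^sup>2"
    using pos_selfadj_norm_le[OF A le, of x] pos_selfadjD(3)[OF A, of x] by linarith
  finally show "norm (x - A x) \<le> norm x"
    by (rule power2_le_imp_le) simp
qed

text \<open>
  Since \<open>\<langle>B\<^sup>n x, x\<rangle> \<le> \<parallel>x\<parallel>\<^sup>2\<close> and all coefficients after the first are nonpositive, each partial sum of
  \<open>\<Sum> c\<^sub>n \<langle>B\<^sup>n x, x\<rangle>\<close> is at least \<open>(\<Sum> c\<^sub>n) \<parallel>x\<parallel>\<^sup>2 \<ge> 0\<close>.
\<close>
lemma pos_selfadj_op_series_sqrt_coeff:
  fixes B :: "'a::{real_inner,banach} \<Rightarrow> 'a"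
  assumes "contraction B" and sa: "\<And>x y. B x \<bullet> y = x \<bullet> B y"
  shows "pos_selfadj (op_series sqrt_coeff B)"
proof -
  interpret contraction B by fact
  let ?S = "op_series sqrt_coeff B"
  have pow_sa: "(B ^^ n) x \<bullet> y = x \<bullet> (B ^^ n) y" for n x y
    by (induction n arbitrary: x y) (simp_all add: sa funpow_swap1)
  have sums_inner: "(\<lambda>n. sqrt_coeff n * ((B ^^ n) x \<bullet> y)) sums (?S x \<bullet> y)" for x y
    using bounded_linear.sums[OF bounded_linear_inner_left
        summable_sums[OF summable_terms[OF summable_abs_sqrt_coeff]], of x y]
    by (simp add: op_series_def)
  have "?S x \<bullet> y = x \<bullet> ?S y" for x y
  proof -
    have "(B ^^ n) y \<bullet> x = (B ^^ n) x \<bullet> y" for n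
      by (simp add: pow_sa inner_commute[of y])
    then have "?S x \<bullet> y = ?S y \<bullet> x"
      using sums_unique2[OF sums_inner[of x y]] sums_inner[of y x] by simp
    then show ?thesis by (simp add: inner_commute)
  qed
  moreover have "0 \<le> ?S x \<bullet> x" for x
  proof (rule LIMSEQ_le_const)
    show "(\<lambda>N. \<Sum>n\<le>N. sqrt_coeff n * ((B ^^ n) x \<bullet> x)) \<longlonglongrightarrow> ?S x \<bullet> x"
      using sums_inner[of x x] by (simp add: sums_def_le)
    have "0 \<le> (\<Sum>n\<le>N. sqrt_coeff n * ((B ^^ n) x \<bullet> x))" for N
    proof -
      have "0 \<le> (\<Sum>n\<le>N. sqrt_coeff n) * (norm x)\<^sup>2"
        by (simp add: sum_sqrt_coeff_nonneg)
      also have "\<dots> \<le> (\<Sum>n\<le>N. sqrt_coeff n * ((B ^^ n) x \<bullet> x))"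
        unfolding sum_distrib_right
      proof (rule sum_mono)
        fix n
        have "(B ^^ n) x \<bullet> x \<le> (norm x)\<^sup>2"
          using norm_cauchy_schwarz[of "(B ^^ n) x" x] mult_right_mono[OF norm_funpow_le[of n x], of "norm x"]
          by (simp add: power2_eq_square)
        then show "sqrt_coeff n * (norm x)\<^sup>2 \<le> sqrt_coeff n * ((B ^^ n) x \<bullet> x)"
          by (cases "n = 0") (auto simp: power2_norm_eq_inner intro: mult_left_mono_neg sqrt_coeff_nonpos)
      qed
      finally show ?thesis .
    qed
    then show "\<exists>N. \<forall>n\<ge>N. 0 \<le> (\<Sum>n\<le>n. sqrt_coeff n * ((B ^^ n) x \<bullet> x))" by blast
  qed
  ultimately show ?thesis
    using bounded_linear_op_series[OF summable_abs_sqrt_coeff] by (simp add: pos_selfadj_def)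
qed

lemma op_series_sqrt_coeff_square:
  assumes "contraction B"
  shows "op_series sqrt_coeff B (op_series sqrt_coeff B x) = x - B x"
proof -
  interpret contraction B by fact
  let ?d = "\<lambda>k. if k = 0 then 1 else if k = 1 then - 1 else 0 :: real"
  have "op_series sqrt_coeff B (op_series sqrt_coeff B x) = op_series ?d B x"
    by (simp only: op_series_compose[OF summable_abs_sqrt_coeff summable_abs_sqrt_coeff]
        sqrt_coeff_convolution)
  also have "\<dots> = (\<Sum>k\<in>{0, 1}. ?d k *\<^sub>R (B ^^ k) x)"
    unfolding op_series_def by (rule suminf_finite) auto
  finally show ?thesis by simp
qed

text \<open>
  After rescaling to \<open>\<parallel>A\<parallel> \<le> 1\<close>, the root is the binomial series of \<open>(1 - t)\<^sup>1\<^sup>/\<^sup>2\<close> in the contraction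
  \<open>B = I - A\<close>.  Convergence in norm up to \<open>\<parallel>B\<parallel> = 1\<close> matters because \<open>A\<close> need not be invertible.
\<close>
theorem ex_pos_sqrt:
  fixes A :: "'a::{real_inner,banach} \<Rightarrow> 'a"
  assumes A: "pos_selfadj A"
  obtains S where "pos_selfadj S" "\<And>x. S (S x) = A x"
    "\<And>C x. bounded_linear C \<Longrightarrow> (\<And>y. C (A y) = A (C y)) \<Longrightarrow> C (S x) = S (C x)"
proof -
  obtain K where K: "0 < K" and A': "pos_selfadj (\<lambda>x. (1 / K) *\<^sub>R A x)"
    and le: "\<And>x. norm ((1 / K) *\<^sub>R A x) \<le> norm x"
    using pos_selfadj_bounded[OF A] by blast
  define B where "B x = x - (1 / K) *\<^sub>R A x" for x
  have B: "contraction B"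
    using contraction_one_minus[OF A' le] by (simp add: B_def[abs_def])
  have Bsa: "B x \<bullet> y = x \<bullet> B y" for x y
    using pos_selfadjD(2)[OF A] by (simp add: B_def inner_diff)
  interpret contraction B by (rule B)
  define S where "S x = sqrt K *\<^sub>R op_series sqrt_coeff B x" for x
  show ?thesis
  proof
    show "pos_selfadj S"
      unfolding S_def[abs_def] using K
      by (intro pos_selfadj_scaleR pos_selfadj_op_series_sqrt_coeff B Bsa) auto
    interpret R: bounded_linear "op_series sqrt_coeff B"
      by (rule bounded_linear_op_series[OF summable_abs_sqrt_coeff])
    show "S (S x) = A x" for x
      using K by (simp add: S_def R.scaleR op_series_sqrt_coeff_square[OF B] B_def)
    show "C (S x) = S (C x)" if C: "bounded_linear C" and "\<And>y. C (A y) = A (C y)" for C x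
    proof -
      interpret C: bounded_linear C by (rule C)
      have "C (B y) = B (C y)" for y
        using that by (simp add: B_def C.diff C.scaleR)
      then show ?thesis
        using op_series_commute[OF summable_abs_sqrt_coeff C] by (simp add: S_def C.scaleR)
    qed
  qed
qed

text \<open>
  Put \<open>y = (S - R) x\<close>.  As the roots commute, \<open>(S + R) y = (S\<^sup>2 - R\<^sup>2) x = 0\<close>, so the nonnegative numbers \<open>\<langle>S y, y\<rangle>\<close> and
  \<open>\<langle>R y, y\<rangle>\<close> vanish, whence \<open>S y = R y = 0\<close> and \<open>\<parallel>y\<parallel>\<^sup>2 = \<langle>x, (S - R) y\<rangle> = 0\<close>.
\<close>
lemma pos_sqrt_unique:
  fixes S R :: "'a::real_inner \<Rightarrow> 'a"
  assumes S: "pos_selfadj S" and R: "pos_selfadj R"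
    and sq: "\<And>x. S (S x) = R (R x)" and comm: "\<And>x. R (S x) = S (R x)"
  shows "S = R"
proof
  fix x
  interpret S: bounded_linear S using pos_selfadjD(1)[OF S] .
  interpret R: bounded_linear R using pos_selfadjD(1)[OF R] .
  define y where "y = S x - R x"
  have "S y + R y = 0"
    unfolding y_def S.diff R.diff by (simp add: sq comm)
  then have "S y \<bullet> y + R y \<bullet> y = 0"
    by (simp flip: inner_add_left)
  then have "S y \<bullet> y = 0" "R y \<bullet> y = 0"
    using pos_selfadjD(3)[OF S, of y] pos_selfadjD(3)[OF R, of y] by linarith+
  then have "S y = 0" "R y = 0"
    by (simp_all add: pos_selfadj_eq_0[OF S] pos_selfadj_eq_0[OF R])
  moreover have "y \<bullet> y = x \<bullet> S y - x \<bullet> R y"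
    using pos_selfadjD(2)[OF S, of x y] pos_selfadjD(2)[OF R, of x y]
      inner_diff_left[of "S x" "R x" y, folded y_def]
    by simp
  ultimately have "y = 0" by simp
  then show "S x = R x" by (simp add: y_def)
qed

section \<open>Riesz representation\<close>

text \<open>
  The representing vector minimises \<open>\<phi> x = \<parallel>x\<parallel>\<^sup>2 - 2 f x\<close>.  By the parallelogram law a minimising
  sequence is Cauchy, and stationarity of \<open>\<phi>\<close> at the minimum in direction \<open>x\<close> reads \<open>f x = \<langle>x, z\<rangle>\<close>.
\<close>
theorem riesz_representation:
  fixes f :: "'a::{real_inner,banach} \<Rightarrow> real"
  assumes f: "bounded_linear f"
  obtains z where "\<And>x. f x = x \<bullet> z"
proof -
  interpret f: bounded_linear f by (rule f)
  define \<phi> where "\<phi> x = (norm x)\<^sup>2 - 2 * f x" for x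
  define m where "m = Inf (range \<phi>)"
  obtain K where K: "\<And>x. norm (f x) \<le> norm x * K"
    using f.bounded by blast
  have "- K\<^sup>2 \<le> \<phi> x" for x
  proof -
    have "0 \<le> (norm x - K)\<^sup>2" by simp
    also have "\<dots> = (norm x)\<^sup>2 - 2 * (norm x * K) + K\<^sup>2"
      by (simp add: power2_diff)
    also have "\<dots> \<le> \<phi> x + K\<^sup>2"
      using K[of x] by (simp add: \<phi>_def)
    finally show ?thesis by simp
  qed
  then have bdd: "bdd_below (range \<phi>)" by (intro bdd_belowI2)
  have m_le: "m \<le> \<phi> x" for x
    unfolding m_def using bdd by (intro cInf_lower) auto
  have "\<exists>x. \<phi> x < m + 1 / real (Suc n)" for n
    using cInf_lessD[of "range \<phi>" "m + 1 / real (Suc n)"] by (auto simp: m_def)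
  then obtain u where u: "\<And>n. \<phi> (u n) < m + 1 / real (Suc n)" by metis
  have para: "(norm (a - b))\<^sup>2 \<le> 2 * \<phi> a + 2 * \<phi> b - 4 * m" for a b
  proof -
    have "(norm (a - b))\<^sup>2 = 2 * \<phi> a + 2 * \<phi> b - 4 * \<phi> ((1 / 2) *\<^sub>R (a + b))"
      unfolding \<phi>_def f.scaleR f.add power2_norm_eq_inner
      by (simp add: inner_diff inner_add algebra_simps)
    also have "\<dots> \<le> 2 * \<phi> a + 2 * \<phi> b - 4 * m"
      using m_le by simp
    finally show ?thesis .
  qed
  have "Cauchy u"
  proof (rule metric_CauchyI)
    fix e :: real assume "0 < e"
    then have "0 < e\<^sup>2 / 4" by simp
    then obtain N where N: "1 / real (Suc N) < e\<^sup>2 / 4"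
      using nat_approx_posE by blast
    have "dist (u i) (u j) < e" if "N \<le> i" "N \<le> j" for i j
    proof -
      have "1 / real (Suc i) \<le> 1 / real (Suc N)" "1 / real (Suc j) \<le> 1 / real (Suc N)"
        using that by (auto simp: frac_le)
      then have "(norm (u i - u j))\<^sup>2 < e\<^sup>2"
        using para[of "u i" "u j"] u[of i] u[of j] N by linarith
      then show ?thesis
        using \<open>0 < e\<close> by (simp add: dist_norm power2_less_imp_less)
    qed
    then show "\<exists>M. \<forall>i\<ge>M. \<forall>j\<ge>M. dist (u i) (u j) < e" by blast
  qed
  then obtain z where z: "u \<longlonglongrightarrow> z"
    using Cauchy_convergent convergent_def by blast
  have "\<phi> z \<le> m"
  proof (rule LIMSEQ_le)
    show "(\<lambda>n. \<phi> (u n)) \<longlonglongrightarrow> \<phi> z"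
      unfolding \<phi>_def by (intro tendsto_intros z f.tendsto)
    show "(\<lambda>n. m + 1 / real (Suc n)) \<longlonglongrightarrow> m"
      using tendsto_add[OF tendsto_const LIMSEQ_inverse_real_of_nat, of m] by (simp add: inverse_eq_divide)
    show "\<exists>N. \<forall>n\<ge>N. \<phi> (u n) \<le> m + 1 / real (Suc n)"
      using u less_imp_le by blast
  qed
  have min: "\<phi> z \<le> \<phi> y" for y
    using \<open>\<phi> z \<le> m\<close> m_le order_trans by blast
  have "f x = x \<bullet> z" for x
  proof (cases "x = 0")
    case False
    \<comment> \<open>The step of size t along x is the best one, and lowers the value by exactly \<open>d\<^sup>2 / \<parallel>x\<parallel>\<^sup>2\<close>.\<close>
    define d where "d = f x - x \<bullet> z"
    define t where "t = d / (norm x)\<^sup>2"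
    have "\<phi> (z + t *\<^sub>R x) = \<phi> z - 2 * t * d + t\<^sup>2 * (norm x)\<^sup>2"
      unfolding \<phi>_def f.scaleR f.add power2_norm_eq_inner d_def
      by (simp add: inner_add inner_commute algebra_simps power2_eq_square)
    also have "\<dots> = \<phi> z - d\<^sup>2 / (norm x)\<^sup>2"
      using False by (simp add: t_def power2_eq_square)
    finally have "d\<^sup>2 / (norm x)\<^sup>2 \<le> 0"
      using min[of "z + t *\<^sub>R x"] by simp
    then have "d = 0" using False by (simp add: divide_le_0_iff)
    then show ?thesis by (simp add: d_def)
  qed simp
  then show ?thesis by (rule that)
qed

section \<open>Adjoints\<close>

instance complex_hilbert \<subseteq> banach ..

lemma cinner_add_right: "cinner x (y + z) = cinner x y + cinner (x::'a::complex_inner) z"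
  by (metis cinner_add_left cinner_commute complex_cnj_add)

lemma cinner_scaleC_right: "cinner x (c *\<^sub>C y) = cnj c * cinner (x::'a::complex_inner) y"
  by (metis cinner_scaleC_left cinner_commute complex_cnj_mult)

lemma cinner_scaleR_left: "cinner (t *\<^sub>R x) y = of_real t * cinner (x::'a::complex_inner) y"
  by (simp add: scaleR_scaleC cinner_scaleC_left)

lemma cinner_scaleR_right: "cinner x (t *\<^sub>R y) = of_real t * cinner (x::'a::complex_inner) y"
  by (simp add: scaleR_scaleC cinner_scaleC_right)

lemma cinner_minus_left: "cinner (- x) y = - cinner (x::'a::complex_inner) y"
  using cinner_scaleR_left[of "- 1" x y] by simp

lemma cinner_minus_right: "cinner x (- y) = - cinner (x::'a::complex_inner) y"
  using cinner_scaleR_right[of x "- 1" y] by simp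

lemma cinner_diff_left: "cinner (x - y) z = cinner x z - cinner (y::'a::complex_inner) z"
  using cinner_add_left[of x "- y" z] by (simp add: cinner_minus_left)

lemma cinner_diff_right: "cinner x (y - z) = cinner x y - cinner (x::'a::complex_inner) z"
  using cinner_add_right[of x y "- z"] by (simp add: cinner_minus_right)

lemma cinner_zero: "cinner 0 x = 0" "cinner (x::'a::complex_inner) 0 = 0"
  using cinner_scaleR_left[of 0 0 x] cinner_scaleR_right[of x 0 0] by simp_all

lemma scaleC_scaleR: "c *\<^sub>C (t *\<^sub>R x) = t *\<^sub>R (c *\<^sub>C (x::'a::complex_inner))"
  by (simp add: scaleR_scaleC scaleC_scaleC mult.commute)

lemma scaleC_zero: "c *\<^sub>C 0 = (0::'a::complex_inner)"
  using scaleC_scaleR[of c 0 0] by simp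

lemma scaleC_minus_right: "c *\<^sub>C (- x) = - (c *\<^sub>C (x::'a::complex_inner))"
  using scaleC_scaleR[of c "- 1" x] by simp

lemma scaleC_diff_right: "c *\<^sub>C (x - y) = c *\<^sub>C x - c *\<^sub>C (y::'a::complex_inner)"
  using scaleC_add_right[of c x "- y"] by (simp add: scaleC_minus_right)

lemma scaleC_minus_one: "(- 1) *\<^sub>C x = - (x::'a::complex_inner)"
  using scaleR_scaleC[of "- 1" x] by simp

text \<open>
  The real inner product with \<open>\<i> y\<close> supplies the imaginary part of the complex one.  This is how
  results about real Hilbert spaces are carried over.
\<close>
lemma inner_imaginary_unit_right: "x \<bullet> (\<i> *\<^sub>C y) = Im (cinner (x::'a::complex_inner) y)"
  by (simp add: inner_eq_Re_cinner cinner_scaleC_right)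

lemma inner_imaginary_unit_left: "(\<i> *\<^sub>C x) \<bullet> y = - Im (cinner (x::'a::complex_inner) y)"
  by (simp add: inner_eq_Re_cinner cinner_scaleC_left)

lemma cinner_ext:
  fixes y z :: "'a::complex_inner"
  assumes "\<And>x. cinner x y = cinner x z"
  shows "y = z"
proof -
  have "(y - z) \<bullet> (y - z) = 0"
    using assms by (simp add: inner_eq_Re_cinner cinner_diff_right)
  then show ?thesis by simp
qed

lemma norm_scaleC: "norm (c *\<^sub>C x) = cmod c * norm (x::'a::complex_inner)"
proof -
  have "(norm (c *\<^sub>C x))\<^sup>2 = Re (c * cnj c * cinner x x)"
    by (simp only: power2_norm_eq_inner inner_eq_Re_cinner cinner_scaleC_left cinner_scaleC_right ac_simps)
  also have "\<dots> = (cmod c)\<^sup>2 * Re (cinner x x)"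
    by (simp add: complex_norm_square[symmetric])
  also have "\<dots> = (cmod c * norm x)\<^sup>2"
    by (simp only: power_mult_distrib power2_norm_eq_inner[of x] inner_eq_Re_cinner)
  finally show ?thesis
    by (rule power2_eq_imp_eq) auto
qed

lemma bounded_linear_scaleC: "bounded_linear (\<lambda>x::'a::complex_inner. c *\<^sub>C x)"
  by (rule bounded_linear_intro[where K = "cmod c"])
    (simp_all add: scaleC_add_right scaleC_scaleR norm_scaleC mult.commute)

lemma bounded_clinearD:
  assumes "bounded_clinear T"
  shows "bounded_linear T" "T (c *\<^sub>C x) = c *\<^sub>C T x" "T (x + y) = T x + T y"
    "T (x - y) = T x - T y" "T (t *\<^sub>R x) = t *\<^sub>R T x" "T 0 = 0" "T (- x) = - T x"
proof -
  show *: "bounded_linear T" and "T (c *\<^sub>C x) = c *\<^sub>C T x"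
    using assms by (auto simp: bounded_clinear_def)
  interpret bounded_linear T by (rule *)
  show "T (x + y) = T x + T y" "T (x - y) = T x - T y" "T (t *\<^sub>R x) = t *\<^sub>R T x" "T 0 = 0"
    "T (- x) = - T x"
    by (rule add diff scaleR zero neg)+
qed

lemma bounded_clinear_ident: "bounded_clinear (\<lambda>x. x)"
  by (simp add: bounded_clinear_def bounded_linear_ident)

lemma bounded_clinear_zero: "bounded_clinear (\<lambda>x. 0)"
  by (simp add: bounded_clinear_def scaleC_zero)

lemma bounded_clinear_compose:
  "bounded_clinear S \<Longrightarrow> bounded_clinear T \<Longrightarrow> bounded_clinear (\<lambda>x. S (T x))"
  by (auto simp: bounded_clinear_def bounded_linear_compose)

lemma bounded_clinear_add:
  "bounded_clinear S \<Longrightarrow> bounded_clinear T \<Longrightarrow> bounded_clinear (\<lambda>x. S x + T x)"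
  by (auto simp: bounded_clinear_def bounded_linear_add scaleC_add_right)

lemma bounded_clinear_diff:
  "bounded_clinear S \<Longrightarrow> bounded_clinear T \<Longrightarrow> bounded_clinear (\<lambda>x. S x - T x)"
  by (auto simp: bounded_clinear_def bounded_linear_sub scaleC_diff_right)

lemma bounded_clinear_minus: "bounded_clinear T \<Longrightarrow> bounded_clinear (\<lambda>x. - T x)"
  by (auto simp: bounded_clinear_def bounded_linear_minus scaleC_minus_right)

lemma bounded_clinear_scaleR: "bounded_clinear T \<Longrightarrow> bounded_clinear (\<lambda>x. t *\<^sub>R T x)"
  by (auto simp: bounded_clinear_def scaleC_scaleR
      intro: bounded_linear_compose[OF bounded_linear_scaleR_right])

lemmas bounded_clinear_intros = bounded_clinear_ident bounded_clinear_zero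
  bounded_clinear_add bounded_clinear_diff bounded_clinear_minus bounded_clinear_scaleR

lemma cadjoint_eqI:
  assumes "\<And>x y. cinner (T x) y = cinner x (S y)"
  shows "cadjoint T = S"
  unfolding cadjoint_def
proof (rule the_equality)
  fix S' assume S': "\<forall>x y. cinner (T x) y = cinner x (S' y)"
  have "S' y = S y" for y
    by (rule cinner_ext) (metis S' assms)
  then show "S' = S" by blast
qed (use assms in blast)

text \<open>
  The real Riesz theorem gives an adjoint \<open>S\<close> for the real inner product.  As \<open>T\<close> commutes with \<open>\<i>\<close>, so
  does \<open>S\<close>, and then the imaginary parts of the complex inner products agree as well.
\<close>
lemma ex_adjoint:
  fixes T :: "'a::complex_hilbert \<Rightarrow> 'b::complex_inner"
  assumes T: "bounded_clinear T"
  obtains S where "bounded_clinear S" "\<And>x y. cinner (T x) y = cinner x (S y)"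
proof -
  note [simp] = bounded_clinearD[OF T]
  have "\<exists>z. \<forall>x. T x \<bullet> y = x \<bullet> z" for y
    using riesz_representation[OF bounded_linear_compose[OF bounded_linear_inner_left bounded_clinearD(1)[OF T]], of y]
    by blast
  then obtain S where S: "\<And>x y. T x \<bullet> y = x \<bullet> S y" by metis
  have ext: "u = v" if "\<And>x. x \<bullet> u = x \<bullet> v" for u v :: 'a
    using that[of "u - v"] inner_diff_right[of "u - v" u v] by simp
  have S_i: "S (\<i> *\<^sub>C y) = \<i> *\<^sub>C S y" for y
  proof (rule ext)
    fix x
    have "x \<bullet> S (\<i> *\<^sub>C y) = T x \<bullet> (\<i> *\<^sub>C y)"
      by (simp add: S)
    also have "\<dots> = - (T (\<i> *\<^sub>C x) \<bullet> y)"
      by (simp add: inner_imaginary_unit_left inner_imaginary_unit_right)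
    also have "\<dots> = x \<bullet> (\<i> *\<^sub>C S y)"
      unfolding S by (simp add: inner_imaginary_unit_left inner_imaginary_unit_right)
    finally show "x \<bullet> S (\<i> *\<^sub>C y) = x \<bullet> (\<i> *\<^sub>C S y)" .
  qed
  have adj: "cinner (T x) y = cinner x (S y)" for x y
  proof (rule complex_eqI)
    show "Re (cinner (T x) y) = Re (cinner x (S y))"
      using S by (simp add: inner_eq_Re_cinner)
    show "Im (cinner (T x) y) = Im (cinner x (S y))"
      using S[of x "\<i> *\<^sub>C y"] by (simp add: S_i inner_imaginary_unit_right)
  qed
  obtain K where K: "0 < K" "\<And>x. norm (T x) \<le> norm x * K"
    using bounded_linear.pos_bounded[OF bounded_clinearD(1)[OF T]] by blast
  have "bounded_linear S"
  proof (rule bounded_linear_intro)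
    show "S (x + y) = S x + S y" for x y
      by (rule ext) (simp add: S[symmetric] inner_add_right)
    show "S (t *\<^sub>R x) = t *\<^sub>R S x" for t x
      by (rule ext) (simp add: S[symmetric])
    show "norm (S y) \<le> norm y * K" for y
    proof (cases "S y = 0")
      case False
      have "norm (S y) * norm (S y) = T (S y) \<bullet> y"
        by (simp add: S flip: power2_norm_eq_inner power2_eq_square)
      also have "\<dots> \<le> norm (T (S y)) * norm y"
        by (rule norm_cauchy_schwarz)
      also have "\<dots> \<le> (norm (S y) * K) * norm y"
        by (intro mult_right_mono K) simp
      finally show ?thesis using False by (simp add: ac_simps)
    qed (use K in simp)
  qed
  moreover have "S (c *\<^sub>C y) = c *\<^sub>C S y" for c y
    by (rule cinner_ext) (simp add: adj[symmetric] cinner_scaleC_right)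
  ultimately have "bounded_clinear S"
    by (simp add: bounded_clinear_def)
  then show ?thesis
    using that adj by blast
qed

lemma
  fixes T :: "'a::complex_hilbert \<Rightarrow> 'b::complex_inner"
  assumes T: "bounded_clinear T"
  shows bounded_clinear_cadjoint: "bounded_clinear (cadjoint T)"
    and cinner_cadjoint_right: "cinner x (cadjoint T y) = cinner (T x) y"
    and cinner_cadjoint_left: "cinner (cadjoint T y) x = cinner y (T x)"
proof -
  obtain S where S: "bounded_clinear S" "\<And>x y. cinner (T x) y = cinner x (S y)"
    using ex_adjoint[OF T] by blast
  have "cadjoint T = S" by (rule cadjoint_eqI[OF S(2)])
  with S show "bounded_clinear (cadjoint T)" and *: "cinner x (cadjoint T y) = cinner (T x) y"
    by auto
  show "cinner (cadjoint T y) x = cinner y (T x)"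
    using * by (metis cinner_commute)
qed

lemma cadjoint_cadjoint:
  fixes T :: "'a::complex_hilbert \<Rightarrow> 'b::complex_inner"
  assumes "bounded_clinear T"
  shows "cadjoint (cadjoint T) = T"
  by (rule cadjoint_eqI) (simp add: cinner_cadjoint_left[OF assms])

text \<open>
  From \<open>\<parallel>T\<^sup>* y\<parallel>\<^sup>2 = \<langle>T T\<^sup>* y, y\<rangle> \<le> K \<parallel>T\<^sup>* y\<parallel> \<parallel>y\<parallel>\<close>.
\<close>
lemma norm_cadjoint_le:
  fixes T :: "'a::complex_hilbert \<Rightarrow> 'b::complex_inner"
  assumes T: "bounded_clinear T" and le: "\<And>x. norm (T x) \<le> K * norm x" and "0 \<le> K"
  shows "norm (cadjoint T y) \<le> K * norm y"
proof (cases "cadjoint T y = 0")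
  case False
  let ?z = "cadjoint T y"
  have "norm ?z * norm ?z = T ?z \<bullet> y"
    by (simp add: inner_eq_Re_cinner cinner_cadjoint_right[OF T, symmetric]
        power2_norm_eq_inner flip: power2_eq_square)
  also have "\<dots> \<le> norm (T ?z) * norm y"
    by (rule norm_cauchy_schwarz)
  also have "\<dots> \<le> (K * norm ?z) * norm y"
    by (intro mult_right_mono le) simp
  finally show ?thesis using False by (simp add: ac_simps)
qed (use assms in simp)

section \<open>Positive operators on complex Hilbert spaces\<close>

text \<open>
  Over the complex numbers a real quadratic form forces symmetry: polarisation of
  \<open>\<langle>A x, \<i> x\<rangle> = 0\<close> (real inner product) at \<open>x - \<i> y\<close> gives \<open>\<langle>A x, y\<rangle> = \<langle>A y, x\<rangle>\<close>.
\<close>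
lemma positive_op_iff: "positive_op A \<longleftrightarrow> bounded_clinear A \<and> pos_selfadj A"
proof safe
  assume A: "positive_op A"
  then show C: "bounded_clinear A" by (simp add: positive_op_def)
  note [simp] = bounded_clinearD[OF C]
  have im: "A x \<bullet> (\<i> *\<^sub>C x) = 0" for x
    using A by (simp add: positive_op_def inner_imaginary_unit_right complex_is_Real_iff)
  have "A x \<bullet> y = x \<bullet> A y" for x y
  proof -
    have "A (x - \<i> *\<^sub>C y) \<bullet> (\<i> *\<^sub>C (x - \<i> *\<^sub>C y)) = 0"
      by (rule im)
    then have "A x \<bullet> y - A y \<bullet> x = 0"
      using im[of x] im[of y]
      by (simp add: scaleC_diff_right scaleC_scaleC scaleC_minus_one inner_eq_Re_cinner
          cinner_diff_left cinner_add_right cinner_scaleC_left cinner_scaleC_right)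
    then show ?thesis by (simp add: inner_commute)
  qed
  then show "pos_selfadj A"
    using A by (auto simp: pos_selfadj_def positive_op_def inner_eq_Re_cinner)
next
  assume C: "bounded_clinear A" and A: "pos_selfadj A"
  have "Im (cinner (A x) x) = 0" for x
    using pos_selfadjD(2)[OF A, of x "\<i> *\<^sub>C x"] bounded_clinearD(2)[OF C, of \<i> x] cinner_commute[of x "A x"]
    by (simp add: inner_imaginary_unit_right)
  moreover have "0 \<le> Re (cinner (A x) x)" for x
    using pos_selfadjD(3)[OF A, of x] by (simp add: inner_eq_Re_cinner)
  ultimately show "positive_op A"
    using C by (simp add: positive_op_def complex_is_Real_iff)
qed

lemma positive_op_bounded_clinear: "positive_op A \<Longrightarrow> bounded_clinear A"
  by (simp add: positive_op_def)

lemma positive_op_selfadj: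
  assumes A: "positive_op A"
  shows "cinner (A x) y = cinner x (A y)"
proof (rule complex_eqI)
  have C: "bounded_clinear A" and A: "pos_selfadj A"
    using A by (auto simp: positive_op_iff)
  show "Re (cinner (A x) y) = Re (cinner x (A y))"
    using pos_selfadjD(2)[OF A] by (simp add: inner_eq_Re_cinner)
  show "Im (cinner (A x) y) = Im (cinner x (A y))"
    using pos_selfadjD(2)[OF A, of x "\<i> *\<^sub>C y"]
    by (simp add: bounded_clinearD(2)[OF C] inner_imaginary_unit_right)
qed

text \<open>
  The series root commutes with everything that commutes with \<open>A\<close>: with scalar multiplications, so
  that it is complex linear, and with any other positive root \<open>R\<close> (because \<open>R A = R\<^sup>3 = A R\<close>), so that
  the two roots coincide by uniqueness among commuting ones.
\<close>
theorem
  fixes A :: "'a::complex_hilbert \<Rightarrow> 'a"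
  assumes A: "positive_op A"
  shows positive_op_sqrt_op: "positive_op (sqrt_op A)"
    and sqrt_op_square: "sqrt_op A (sqrt_op A x) = A x"
    and sqrt_op_commute:
      "bounded_linear C \<Longrightarrow> (\<And>y. C (A y) = A (C y)) \<Longrightarrow> C (sqrt_op A x) = sqrt_op A (C x)"
proof -
  have cA: "bounded_clinear A" and pA: "pos_selfadj A"
    using A by (auto simp: positive_op_iff)
  obtain S where S: "pos_selfadj S" and sq: "\<And>x. S (S x) = A x"
    and comm: "\<And>C x. bounded_linear C \<Longrightarrow> (\<And>y. C (A y) = A (C y)) \<Longrightarrow> C (S x) = S (C x)"
    using ex_pos_sqrt[OF pA] by blast
  have "S (c *\<^sub>C x) = c *\<^sub>C S x" for c x
    using comm[OF bounded_linear_scaleC[of c]] by (simp add: bounded_clinearD(2)[OF cA])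
  then have pS: "positive_op S"
    using S by (auto simp: positive_op_iff bounded_clinear_def dest: pos_selfadjD(1))
  have "sqrt_op A = S"
    unfolding sqrt_op_def
  proof (rule the_equality)
    show "positive_op S \<and> S \<circ> S = A"
      using pS sq by auto
    fix R assume R: "positive_op R \<and> R \<circ> R = A"
    then have RR: "R (R x) = A x" for x by (auto simp: fun_eq_iff)
    have pR: "pos_selfadj R" using R by (simp add: positive_op_iff)
    have "R (S x) = S (R x)" for x
      by (rule comm[OF pos_selfadjD(1)[OF pR]]) (simp flip: RR)
    then have "R = S"
      using pos_sqrt_unique[OF S pR] by (simp add: sq RR)
    then show "R = S" .
  qed
  then show "positive_op (sqrt_op A)" "sqrt_op A (sqrt_op A x) = A x"
    "bounded_linear C \<Longrightarrow> (\<And>y. C (A y) = A (C y)) \<Longrightarrow> C (sqrt_op A x) = sqrt_op A (C x)"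
    using pS sq comm by auto
qed

text \<open>
  If \<open>A\<close> commutes with \<open>B\<close>, it commutes with \<open>B\<^sup>1\<^sup>/\<^sup>2\<close>, so \<open>\<langle>A B x, x\<rangle> = \<langle>A B\<^sup>1\<^sup>/\<^sup>2 x, B\<^sup>1\<^sup>/\<^sup>2 x\<rangle> \<ge> 0\<close>.
\<close>
lemma positive_op_commuting_product:
  fixes A B :: "'a::complex_hilbert \<Rightarrow> 'a"
  assumes A: "positive_op A" and B: "positive_op B" and comm: "\<And>x. A (B x) = B (A x)"
  shows "positive_op (\<lambda>x. A (B x))"
  unfolding positive_op_def
proof (intro conjI allI)
  have cA: "bounded_clinear A" by (rule positive_op_bounded_clinear[OF A])
  show "bounded_clinear (\<lambda>x. A (B x))"
    by (rule bounded_clinear_compose[OF cA positive_op_bounded_clinear[OF B]])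
  fix x
  let ?S = "sqrt_op B"
  have "cinner (A (B x)) x = cinner (?S (A (?S x))) x"
    by (simp add: sqrt_op_commute[OF B bounded_clinearD(1)[OF cA] comm, symmetric] sqrt_op_square[OF B])
  also have "\<dots> = cinner (A (?S x)) (?S x)"
    by (rule positive_op_selfadj[OF positive_op_sqrt_op[OF B]])
  finally show "cinner (A (B x)) x \<in> \<real>" "0 \<le> Re (cinner (A (B x)) x)"
    using A by (simp_all add: positive_op_def)
qed

lemma cinner_self: "cinner (x::'a::complex_inner) x = of_real ((norm x)\<^sup>2)"
proof (rule complex_eqI)
  show "Im (cinner x x) = Im (of_real ((norm x)\<^sup>2))"
    using cinner_commute[of x x] by (metis Im_complex_of_real Reals_cnj_iff complex_is_Real_iff)
qed (simp add: power2_norm_eq_inner inner_eq_Re_cinner)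

lemma positive_op_cadjoint_compose:
  fixes T :: "'a::complex_hilbert \<Rightarrow> 'b::complex_hilbert"
  assumes T: "bounded_clinear T"
  shows "positive_op (\<lambda>x. cadjoint T (T x))"
  unfolding positive_op_def
  by (simp add: cinner_cadjoint_left[OF T] cinner_self
      bounded_clinear_compose[OF bounded_clinear_cadjoint[OF T] T])

lemma positive_op_norm_bound_diff:
  fixes T :: "'a::complex_hilbert \<Rightarrow> 'b::complex_hilbert"
  assumes T: "bounded_clinear T" and le: "\<And>x. norm (T x) \<le> r * norm x"
  shows "positive_op (\<lambda>x. r\<^sup>2 *\<^sub>R x - cadjoint T (T x))"
  unfolding positive_op_def
proof (intro conjI allI)
  show "bounded_clinear (\<lambda>x. r\<^sup>2 *\<^sub>R x - cadjoint T (T x))"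
    by (intro bounded_clinear_intros bounded_clinear_compose[OF bounded_clinear_cadjoint[OF T] T])
  fix x
  have "cinner (r\<^sup>2 *\<^sub>R x - cadjoint T (T x)) x = of_real ((r * norm x)\<^sup>2 - (norm (T x))\<^sup>2)"
    by (simp add: cinner_diff_left cinner_scaleR_left cinner_cadjoint_left[OF T] cinner_self power_mult_distrib)
  moreover have "(norm (T x))\<^sup>2 \<le> (r * norm x)\<^sup>2"
    by (rule power_mono[OF le]) simp
  ultimately show "cinner (r\<^sup>2 *\<^sub>R x - cadjoint T (T x)) x \<in> \<real>"
    "0 \<le> Re (cinner (r\<^sup>2 *\<^sub>R x - cadjoint T (T x)) x)"
    by (simp_all del: of_real_diff)
qed

lemma positive_op_scaleR: "positive_op A \<Longrightarrow> 0 \<le> t \<Longrightarrow> positive_op (\<lambda>x. t *\<^sub>R A x)"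
  by (simp add: positive_op_iff pos_selfadj_scaleR bounded_clinear_scaleR)

section \<open>Block operators\<close>

lemma bounded_clinear_block_op:
  assumes "bounded_clinear A" "bounded_clinear B" "bounded_clinear C" "bounded_clinear D"
  shows "bounded_clinear (block_op A B C D)"
proof -
  note lin = assms[THEN bounded_clinearD(1)]
  have "bounded_linear (\<lambda>p. (A (fst p) + B (snd p), C (fst p) + D (snd p)))"
    by (intro bounded_linear_Pair bounded_linear_add
        bounded_linear_compose[OF lin(1) bounded_linear_fst] bounded_linear_compose[OF lin(2) bounded_linear_snd]
        bounded_linear_compose[OF lin(3) bounded_linear_fst] bounded_linear_compose[OF lin(4) bounded_linear_snd])
  then show ?thesis
    by (simp add: bounded_clinear_def block_op_def split_def scaleC_prod_def scaleC_add_right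
        assms[THEN bounded_clinearD(2)])
qed

lemma cadjoint_block_op:
  fixes A B C D :: "'a::complex_hilbert \<Rightarrow> 'a"
  assumes "bounded_clinear A" "bounded_clinear B" "bounded_clinear C" "bounded_clinear D"
  shows "cadjoint (block_op A B C D) = block_op (cadjoint A) (cadjoint C) (cadjoint B) (cadjoint D)"
  by (rule cadjoint_eqI)
    (auto simp: block_op_def cinner_prod_def cinner_add_left cinner_add_right
      assms[THEN cinner_cadjoint_right])

section \<open>Operators in the quantum annulus\<close>

lemma invertible_opD:
  assumes "invertible_op T"
  shows "bounded_clinear T" "bounded_clinear (inv T)" "inv T (T x) = x" "T (inv T x) = x"
proof -
  obtain S where S: "bounded_clinear S" "S \<circ> T = id" "T \<circ> S = id"
    using assms by (auto simp: invertible_op_def)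
  then have "inv T = S" by (metis inv_unique_comp)
  with S show "bounded_clinear (inv T)" "inv T (T x) = x" "T (inv T x) = x"
    by (simp_all add: pointfree_idE)
  show "bounded_clinear T" using assms by (simp add: invertible_op_def)
qed

lemma
  fixes T :: "'a::complex_hilbert \<Rightarrow> 'a"
  assumes T: "invertible_op T"
  shows cadjoint_cadjoint_inv: "cadjoint T (cadjoint (inv T) x) = x"
    and cadjoint_inv_cadjoint: "cadjoint (inv T) (cadjoint T x) = x"
  by (rule cinner_ext, simp add: invertible_opD[OF T] cinner_cadjoint_right[OF invertible_opD(1)[OF T]]
      cinner_cadjoint_right[OF invertible_opD(2)[OF T]])+

lemma inv_cadjoint_compose:
  fixes T :: "'a::complex_hilbert \<Rightarrow> 'a"
  assumes T: "invertible_op T"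
  shows "inv (cadjoint T \<circ> T) = inv T \<circ> cadjoint (inv T)"
  by (rule inv_unique_comp)
    (auto simp: fun_eq_iff invertible_opD[OF T] cadjoint_cadjoint_inv[OF T] cadjoint_inv_cadjoint[OF T])

text \<open>
  In what follows \<open>P = T\<^sup>* T\<close>, \<open>P' = P\<^sup>-\<^sup>1\<close>, and \<open>Q\<close>, \<open>R\<close> are the positive square roots of \<open>P'\<close> and of
  \<open>\<beta> = c I - P - P'\<close>.  All four operators commute with one another, which reduces the block
  computations to commutative algebra.
\<close>
locale quantum_annulus_operator =
  fixes r :: real and T :: "'a::complex_hilbert \<Rightarrow> 'a"
  assumes r: "0 < r" and mem: "T \<in> quantum_annulus r"
begin

definition P :: "'a \<Rightarrow> 'a" where "P x = cadjoint T (T x)"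
definition P' :: "'a \<Rightarrow> 'a" where "P' x = inv T (cadjoint (inv T) x)"

abbreviation "c \<equiv> r\<^sup>2 + 1 / r\<^sup>2"

lemma inv_T: "invertible_op T"
  using mem by (simp add: quantum_annulus_def)

lemmas cT = invertible_opD(1)[OF inv_T]
lemmas cV = invertible_opD(2)[OF inv_T]
lemmas cTa = bounded_clinear_cadjoint[OF cT]
lemmas cVa = bounded_clinear_cadjoint[OF cV]

lemmas inverse_simps [simp] = invertible_opD(3,4)[OF inv_T] cadjoint_cadjoint_inv[OF inv_T]
  cadjoint_inv_cadjoint[OF inv_T]

lemma norm_T_le: "norm (T x) \<le> r * norm x"
proof -
  have "norm (T x) \<le> onorm T * norm x"
    by (rule onorm[OF bounded_clinearD(1)[OF cT]])
  also have "\<dots> \<le> r * norm x"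
    using mem by (intro mult_right_mono) (auto simp: quantum_annulus_def)
  finally show ?thesis .
qed

lemma norm_inv_T_le: "norm (inv T x) \<le> r * norm x"
proof -
  have "norm (inv T x) \<le> onorm (inv T) * norm x"
    by (rule onorm[OF bounded_clinearD(1)[OF cV]])
  also have "\<dots> \<le> r * norm x"
    using mem by (intro mult_right_mono) (auto simp: quantum_annulus_def)
  finally show ?thesis .
qed

lemma P_P' [simp]: "P (P' x) = x" "P' (P x) = x"
  by (simp_all add: P_def P'_def)

lemma positive_P: "positive_op P"
  using positive_op_cadjoint_compose[OF cT] by (simp add: P_def[abs_def])

lemma positive_P': "positive_op P'"
  using positive_op_cadjoint_compose[OF cVa] by (simp add: P'_def[abs_def] cadjoint_cadjoint[OF cV])

lemmas cP = positive_op_bounded_clinear[OF positive_P]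
lemmas cP' = positive_op_bounded_clinear[OF positive_P']
lemmas P_linear = bounded_clinearD(3-7)[OF cP]
lemmas P'_linear = bounded_clinearD(3-7)[OF cP']

lemma inv_cadjoint_compose_eq: "inv (cadjoint T \<circ> T) = P'"
  by (simp add: inv_cadjoint_compose[OF inv_T] P'_def fun_eq_iff)

lemma beta_eq: "beta r T x = c *\<^sub>R x - P x - P' x"
  by (simp add: beta_def inv_cadjoint_compose_eq P_def)

text \<open>
  The factorisation \<open>r\<^sup>2 \<beta> = (r\<^sup>2 I - P) (r\<^sup>2 I - P')\<close> writes \<open>r\<^sup>2 \<beta>\<close> as a product of commuting operators.
  The first is positive because \<open>\<parallel>T\<parallel> \<le> r\<close>, the second because \<open>P'\<close> is the Gram operator of \<open>T\<^sup>-\<^sup>*\<close> and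
  \<open>\<parallel>T\<^sup>-\<^sup>*\<parallel> \<le> r\<close>.
\<close>
lemma positive_beta: "positive_op (beta r T)"
proof -
  define A where "A x = r\<^sup>2 *\<^sub>R x - P x" for x
  define B where "B x = r\<^sup>2 *\<^sub>R x - P' x" for x
  have A: "positive_op A"
    using positive_op_norm_bound_diff[OF cT norm_T_le] by (simp add: A_def[abs_def] P_def)
  have B: "positive_op B"
    using positive_op_norm_bound_diff[OF cVa norm_cadjoint_le[OF cV norm_inv_T_le]] r
    by (simp add: B_def[abs_def] P'_def cadjoint_cadjoint[OF cV])
  have AB: "A (B x) = r\<^sup>2 *\<^sub>R beta r T x" and BA: "B (A x) = r\<^sup>2 *\<^sub>R beta r T x" for x
    using r by (simp_all add: A_def B_def beta_eq P_linear P'_linear scaleR_diff_right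
        scaleR_add_left scaleR_add_right)
  have "positive_op (\<lambda>x. (1 / r\<^sup>2) *\<^sub>R A (B x))"
    by (rule positive_op_scaleR[OF positive_op_commuting_product[OF A B]]) (simp_all add: AB BA)
  moreover have "(\<lambda>x. (1 / r\<^sup>2) *\<^sub>R A (B x)) = beta r T"
    using r by (simp add: AB fun_eq_iff)
  ultimately show ?thesis by simp
qed

definition Q :: "'a \<Rightarrow> 'a" where "Q = sqrt_op P'"
definition R :: "'a \<Rightarrow> 'a" where "R = sqrt_op (beta r T)"

lemma positive_Q: "positive_op Q" and positive_R: "positive_op R"
  by (simp_all add: Q_def R_def positive_op_sqrt_op positive_P' positive_beta)

lemmas cQ = positive_op_bounded_clinear[OF positive_Q]
lemmas cR = positive_op_bounded_clinear[OF positive_R]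

lemma Q_Q: "Q (Q x) = P' x" and R_R: "R (R x) = beta r T x"
  by (simp_all add: Q_def R_def sqrt_op_square positive_P' positive_beta)

lemma P_Q: "P (Q x) = Q (P x)"
  unfolding Q_def by (rule sqrt_op_commute[OF positive_P' bounded_clinearD(1)[OF cP]]) simp

lemma P'_Q: "P' (Q x) = Q (P' x)"
  unfolding Q_def by (rule sqrt_op_commute[OF positive_P' bounded_clinearD(1)[OF cP']]) simp

lemma beta_P: "beta r T (P x) = P (beta r T x)"
  by (simp add: beta_eq P_linear)

lemma beta_Q: "beta r T (Q x) = Q (beta r T x)"
  by (simp add: beta_eq bounded_clinearD(3-7)[OF cQ] P_Q P'_Q)

lemma P_R: "P (R x) = R (P x)"
  unfolding R_def
  by (rule sqrt_op_commute[OF positive_beta bounded_clinearD(1)[OF cP]]) (simp add: beta_P)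

lemma Q_R: "Q (R x) = R (Q x)"
  unfolding R_def
  by (rule sqrt_op_commute[OF positive_beta bounded_clinearD(1)[OF cQ]]) (simp add: beta_Q)

text \<open>
  The operator \<open>D\<close> is the off-diagonal entry \<open>T P\<^sup>-\<^sup>1\<^sup>/\<^sup>2 \<beta>\<^sup>1\<^sup>/\<^sup>2\<close> of the extension, and \<open>K = T\<^sup>* D\<close> is, up to
  rewriting, the self-adjoint operator \<open>P\<^sup>1\<^sup>/\<^sup>2 \<beta>\<^sup>1\<^sup>/\<^sup>2\<close>.  Writing \<open>P Q\<close> for \<open>P\<^sup>1\<^sup>/\<^sup>2\<close> avoids a third square root.
\<close>
definition D :: "'a \<Rightarrow> 'a" where "D x = T (Q (R x))"
definition K :: "'a \<Rightarrow> 'a" where "K x = P (Q (R x))"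

lemma cD: "bounded_clinear D"
  unfolding D_def[abs_def] by (rule bounded_clinear_compose[OF cT bounded_clinear_compose[OF cQ cR]])

lemma cK: "bounded_clinear K"
  unfolding K_def[abs_def] by (rule bounded_clinear_compose[OF cP bounded_clinear_compose[OF cQ cR]])

lemma cadjoint_D: "cadjoint D = (\<lambda>y. R (Q (cadjoint T y)))"
  by (rule cadjoint_eqI)
    (simp add: D_def cinner_cadjoint_right[OF cT] positive_op_selfadj[OF positive_Q, symmetric]
      positive_op_selfadj[OF positive_R, symmetric])

lemma K_K: "K (K x) = P (beta r T x)"
  by (simp add: K_def P_Q P_R Q_R Q_Q R_R beta_P beta_Q)

lemma T_hat_eq: "T_hat r T = block_op T D (\<lambda>x. 0) (cadjoint (inv T))"
  unfolding T_hat_def inv_cadjoint_compose_eq by (simp add: D_def[abs_def] Q_def R_def o_def)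

lemma cadjoint_T_hat: "cadjoint (T_hat r T) = block_op (cadjoint T) (\<lambda>x. 0) (cadjoint D) (inv T)"
proof -
  have "cadjoint (\<lambda>x::'a. 0::'a) = (\<lambda>x. 0)"
    by (rule cadjoint_eqI) (simp add: cinner_zero)
  then show ?thesis
    by (simp add: T_hat_eq cadjoint_block_op cT cD bounded_clinear_zero cVa cadjoint_cadjoint[OF cV])
qed

text \<open>
  Here \<open>D\<^sup>* D = \<beta>\<close>, because \<open>T P\<^sup>-\<^sup>1\<^sup>/\<^sup>2\<close> is the unitary factor of the polar decomposition of \<open>T\<close>.  Hence
  the lower right corner is \<open>D\<^sup>* D + P\<^sup>-\<^sup>1 = \<beta> + P\<^sup>-\<^sup>1 = c I - P\<close>.
\<close>
lemma cadjoint_T_hat_compose: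
  "cadjoint (T_hat r T) \<circ> T_hat r T = block_op P K K (\<lambda>x. c *\<^sub>R x - P x)"
proof -
  have "cadjoint D (T x) = K x" for x
    by (simp add: cadjoint_D K_def P_def[symmetric] P_Q P_R Q_R)
  moreover have "cadjoint D (D x) = beta r T x" for x
    by (simp add: cadjoint_D D_def P_def[symmetric] P_Q P_R Q_R Q_Q R_R beta_P beta_Q)
  ultimately show ?thesis
    unfolding cadjoint_T_hat unfolding T_hat_eq
    by (simp add: fun_eq_iff block_op_def P_def[symmetric] P'_def[symmetric] D_def K_def
        bounded_clinearD(3-7)[OF cTa] bounded_clinearD(3-7)[OF bounded_clinear_cadjoint[OF cD]] beta_eq)
qed

text \<open>
  The entries of the Gram matrix commute and its determinant is
  \<open>P (c I - P) - K\<^sup>2 = P (c I - P - \<beta>) = P P\<^sup>-\<^sup>1 = I\<close>, so the inverse is the adjugate matrix.  Adding the two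
  matrices leaves \<open>c I\<close>.
\<close>
lemma inv_cadjoint_T_hat_compose:
  "inv (cadjoint (T_hat r T) \<circ> T_hat r T) = block_op (\<lambda>x. c *\<^sub>R x - P x) (\<lambda>x. - K x) (\<lambda>x. - K x) P"
  unfolding cadjoint_T_hat_compose
proof (rule inv_unique_comp)
  have PK: "P (K x) = K (P x)" for x
    by (simp add: K_def P_Q P_R)
  note simps = fun_eq_iff block_op_def P_linear bounded_clinearD(3-7)[OF cK] PK K_K beta_eq
    scaleR_add_left scaleR_add_right scaleR_diff_right
  show "block_op P K K (\<lambda>x. c *\<^sub>R x - P x) \<circ> block_op (\<lambda>x. c *\<^sub>R x - P x) (\<lambda>x. - K x) (\<lambda>x. - K x) P = id"
    by (simp add: simps)
  show "block_op (\<lambda>x. c *\<^sub>R x - P x) (\<lambda>x. - K x) (\<lambda>x. - K x) P \<circ> block_op P K K (\<lambda>x. c *\<^sub>R x - P x) = id"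
    by (simp add: simps)
qed

lemma beta_T_hat: "beta r (T_hat r T) = (\<lambda>x. 0)"
  unfolding beta_def inv_cadjoint_T_hat_compose unfolding cadjoint_T_hat_compose
  by (auto simp: fun_eq_iff block_op_def scaleR_prod_def minus_prod_def zero_prod_def)

lemma invertible_T_hat: "invertible_op (T_hat r T)"
proof -
  \<comment> \<open>The inverse of an upper triangular block matrix with invertible diagonal entries.\<close>
  define S where "S = block_op (inv T) (\<lambda>y. - inv T (D (cadjoint T y))) (\<lambda>x. 0) (cadjoint T)"
  have cS: "bounded_clinear S" unfolding S_def
    by (intro bounded_clinear_block_op cV cTa bounded_clinear_zero bounded_clinear_minus
        bounded_clinear_compose[OF cV bounded_clinear_compose[OF cD cTa]])
  have cJ: "bounded_clinear (T_hat r T)" unfolding T_hat_eq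
    by (intro bounded_clinear_block_op cT cD bounded_clinear_zero cVa)
  have "S \<circ> T_hat r T = id" "T_hat r T \<circ> S = id"
    by (simp_all add: fun_eq_iff S_def T_hat_eq block_op_def bounded_clinearD(3-7)[OF cT] bounded_clinearD(3-7)[OF cV])
  then show ?thesis
    using cS cJ by (auto simp: invertible_op_def)
qed

lemma extends_to_T_hat: "extends_to T (T_hat r T)"
  by (auto simp: extends_to_def first_summand_def T_hat_eq block_op_def
      bounded_clinearD(6)[OF cD] bounded_clinearD(6)[OF cVa])

text \<open>
  Invertibility of \<open>T\<close> makes the first summand invariant under the inverse of the extension as well, so
  an extension also dilates the negative powers.
\<close>
lemma op_powi_T_hat: "op_powi (T_hat r T) n (x, 0) = (op_powi T n x, 0)"
proof -
  have J: "T_hat r T (x, 0) = (T x, 0)" for x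
    using extends_to_T_hat by (simp add: extends_to_def)
  have V: "inv (T_hat r T) (x, 0) = (inv T x, 0)" for x
    by (metis J invertible_opD(3)[OF invertible_T_hat] inverse_simps(2))
  have "(T_hat r T ^^ k) (x, 0) = ((T ^^ k) x, 0)" for k
    by (induction k) (simp_all add: J)
  moreover have "(inv (T_hat r T) ^^ k) (x, 0) = ((inv T ^^ k) x, 0)" for k
    by (induction k) (simp_all add: V)
  ultimately show ?thesis by (simp add: op_powi_def)
qed

end

lemma orth_proj_mem:
  assumes "p \<in> M" and "\<And>q. q \<in> M \<Longrightarrow> p - q \<in> M"
  shows "orth_proj M p = p"
  unfolding orth_proj_def
proof (rule the_equality)
  fix q assume q: "q \<in> M \<and> (\<forall>m\<in>M. cinner (p - q) m = 0)"
  then have "cinner (p - q) (p - q) = 0"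
    using assms(2) by blast
  then show "q = p" by (simp add: cinner_self)
qed (use assms in \<open>simp add: cinner_zero\<close>)

theorem theorem2p1:
  fixes r :: real and T :: "'a::complex_hilbert \<Rightarrow> 'a"
  assumes "r > 1"
    and "T \<in> quantum_annulus r"
  shows "quantum_annulus_unitary r (T_hat r T) \<and> extends_to T (T_hat r T) \<and> dilates_to T (T_hat r T)"
proof -
  interpret quantum_annulus_operator r T
    using assms by unfold_locales auto
  have "orth_proj first_summand (y, 0) = (y, 0)" for y :: 'a
    by (rule orth_proj_mem) (auto simp: first_summand_def)
  then show ?thesis
    by (simp add: quantum_annulus_unitary_def invertible_T_hat beta_T_hat extends_to_T_hat
        dilates_to_def op_powi_T_hat)
qed

end
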